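(* Let $T$ be a clean lattice tetrahedron with $\mathrm{vol}(T)=n/6$, and let $w\in\mathbb{Z}^3$ be an interior point of $T$ whose barycentric coordinates with respect to $T$ are $(d_1/N,d_2/N,d_3/N,d_4/N)$, where $d_1,\dots,d_4$ are positive integers with $\sum_j d_j=N$ and $\gcd(d_j,N)=1$ for each $j$; put $g=n/N$. (i) If $T$ is a 1-point lattice tetrahedron, then for every integer $s$ with $2\le s\le N-1$ one has $\sum_{j=1}^4\{sd_j/N\}>1$. (ii) If $g=1$ and $\sum_{j=1}^4\{sd_j/N\}>1$ for every integer $s$ with $2\le s\le N-1$, then $T$ is a 1-point lattice tetrahedron.
   Context: A lattice tetrahedron is a non-degenerate tetrahedron with vertices in $\mathbb{Z}^3$; it is clean if the only lattice points on its boundary are its vertices, and a 1-point lattice tetrahedron if it is clean with exactly one interior lattice point. Barycentric coordinates of $w$ with respect to $T=\mathrm{conv}(v_1,\dots,v_4)$ are the reals $\lambda_j$ with $w=\sum\lambda_jv_j$, $\sum\lambda_j=1$. For real $x$, $\{x\}=x-\lfloor x\rfloor\in[0,1)$ denotes the fractional part. (For a clean lattice tetrahedron, $n=6\,\mathrm{vol}(T)$ is a positive integer and $N$ divides $n$.) *)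

theory Defs
  imports "HOL-Analysis.Analysis"
begin

definition integer_lattice :: "(real^3) set" where
  "integer_lattice = {x. \<forall>i. x $ i \<in> \<int>}"

text \<open>A tetrahedron is given by its family of vertices \<open>v\<close>, labelled by the four-element
  type \<open>4\<close>; as a point set it is the convex hull of their range.\<close>

definition tetrahedron :: "(4 \<Rightarrow> real^3) \<Rightarrow> (real^3) set" where
  "tetrahedron v = convex hull (range v)"

text \<open>Non-degeneracy needs both injectivity and affine independence, because
  \<^const>\<open>affine_dependent\<close> only sees the set of vertices.\<close>

definition lattice_tetrahedron :: "(4 \<Rightarrow> real^3) \<Rightarrow> bool" where
  "lattice_tetrahedron v \<longleftrightarrow>
     inj v \<and> \<not> affine_dependent (range v) \<and> range v \<subseteq> integer_lattice"

definition clean_lattice_tetrahedron :: "(4 \<Rightarrow> real^3) \<Rightarrow> bool" where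
  "clean_lattice_tetrahedron v \<longleftrightarrow>
     lattice_tetrahedron v \<and> frontier (tetrahedron v) \<inter> integer_lattice = range v"

definition one_point_lattice_tetrahedron :: "(4 \<Rightarrow> real^3) \<Rightarrow> bool" where
  "one_point_lattice_tetrahedron v \<longleftrightarrow>
     clean_lattice_tetrahedron v \<and> card (interior (tetrahedron v) \<inter> integer_lattice) = 1"

definition barycentric_coordinates :: "(4 \<Rightarrow> real^3) \<Rightarrow> real^3 \<Rightarrow> (4 \<Rightarrow> real) \<Rightarrow> bool" where
  "barycentric_coordinates v w l \<longleftrightarrow>
     w = (\<Sum>j\<in>UNIV. l j *\<^sub>R v j) \<and> (\<Sum>j\<in>UNIV. l j) = 1"

end

theory Submission
  imports Defs "HOL-Number_Theory.Cong"
begin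

text \<open>By cleanness the face opposite to \<open>v 1\<close> is an empty lattice triangle, hence unimodular, so modulo
  the lattice spanned by the edges at \<open>v 4\<close> a lattice point is determined by its first barycentric
  coordinate. That coordinate times \<open>n\<close>, the determinant of the edges, is an integer by Cramer's rule.
  If \<open>n = N\<close>, then \<open>gcd(d 1, N) = 1\<close> therefore makes every interior lattice point congruent to some
  multiple \<open>s\<close> of \<open>w\<close>, and its coordinates are the fractional parts \<open>{s d j / N}\<close>. Conversely, fractional
  parts summing to \<open>1\<close> are the coordinates of an interior lattice point, which differs from \<open>w\<close>
  unless \<open>s\<close> is \<open>1\<close> modulo \<open>N\<close>.\<close>

section \<open>Barycentric coordinates, interior and boundary\<close>

text \<open>The difference of two coordinate families, carried to the vertices by
  \<open>inv v\<close>, has total weight 0 and weighted sum 0; if nonzero, it would be an affine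
  dependence.\<close>

lemma barycentric_coordinates_unique:
  assumes "lattice_tetrahedron v" "barycentric_coordinates v y l" "barycentric_coordinates v y m"
  shows "l = m"
proof (rule ccontr)
  assume "l \<noteq> m"
  then obtain k where k: "l k \<noteq> m k" by auto
  have inj: "inj v" and ind: "\<not> affine_dependent (range v)"
    using assms(1) by (auto simp: lattice_tetrahedron_def)
  define U where "U = (\<lambda>x. l (inv v x) - m (inv v x))"
  have U: "U (v j) = l j - m j" for j by (simp add: U_def inj)
  have "sum U (range v) = 0" "(\<Sum>x\<in>range v. U x *\<^sub>R x) = 0"
    using assms(2,3)
    by (simp_all add: sum.reindex[OF inj] o_def U sum_subtractf scaleR_diff_left barycentric_coordinates_def)
  moreover have "\<exists>x\<in>range v. U x \<noteq> 0" using k U by auto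
  ultimately show False using ind by (subst (asm) affine_dependent_explicit_finite) auto
qed

text \<open>Translates weights on the vertex set, as in the library descriptions of the interior and
  frontier of a simplex, into weights on labels. \<open>Q\<close> switches on the vanishing
  coordinate that marks the frontier.\<close>

lemma barycentric_coordinates_witness:
  assumes "inj v"
  shows "(\<exists>u. (\<forall>x\<in>range v. P (u x)) \<and> (Q \<longrightarrow> (\<exists>x\<in>range v. u x = 0)) \<and>
            sum u (range v) = 1 \<and> (\<Sum>x\<in>range v. u x *\<^sub>R x) = y) \<longleftrightarrow>
         (\<exists>l. (\<forall>j. P (l j)) \<and> (Q \<longrightarrow> (\<exists>j. l j = 0)) \<and> barycentric_coordinates v y l)"
    (is "?L \<longleftrightarrow> ?R")
proof
  assume ?L
  then obtain u where u: "\<forall>x\<in>range v. P (u x)" "Q \<longrightarrow> (\<exists>x\<in>range v. u x = 0)"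
    "sum u (range v) = 1" "(\<Sum>x\<in>range v. u x *\<^sub>R x) = y" by blast
  then show ?R
    by (intro exI[of _ "u \<circ> v"]) (auto simp: sum.reindex[OF assms] o_def barycentric_coordinates_def)
next
  assume ?R
  then obtain l where l: "\<forall>j. P (l j)" "Q \<longrightarrow> (\<exists>j. l j = 0)" "barycentric_coordinates v y l"
    by blast
  then show ?L
    by (intro exI[of _ "l \<circ> inv v"])
      (auto simp: sum.reindex[OF assms] o_def inv_f_f[OF assms] barycentric_coordinates_def)
qed

lemma card_range_vertices:
  assumes "lattice_tetrahedron v"
  shows "card (range v) = 4"
  using assms by (simp add: lattice_tetrahedron_def card_image)

lemma interior_tetrahedron:
  assumes "lattice_tetrahedron v"
  shows "interior (tetrahedron v) = {y. \<exists>l. (\<forall>j. 0 < l j) \<and> barycentric_coordinates v y l}"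
proof -
  have inj: "inj v" and ind: "\<not> affine_dependent (range v)"
    using assms by (auto simp: lattice_tetrahedron_def)
  show ?thesis
    unfolding tetrahedron_def interior_convex_hull_explicit_minimal[OF ind]
    using barycentric_coordinates_witness[OF inj, of "\<lambda>t. 0 < t" False]
    by (simp add: card_range_vertices[OF assms])
qed

lemma frontier_tetrahedron:
  assumes "lattice_tetrahedron v"
  shows "frontier (tetrahedron v) =
    {y. \<exists>l. (\<forall>j. 0 \<le> l j) \<and> (\<exists>j. l j = 0) \<and> barycentric_coordinates v y l}"
proof -
  have inj: "inj v" and ind: "\<not> affine_dependent (range v)"
    using assms by (auto simp: lattice_tetrahedron_def)
  show ?thesis
    unfolding tetrahedron_def frontier_convex_hull_explicit[OF ind]
    using barycentric_coordinates_witness[OF inj, of "\<lambda>t. 0 \<le> t" True]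
    by (simp add: card_range_vertices[OF assms])
qed

section \<open>The integer lattice and the empty face\<close>

lemma integer_lattice_add: "x \<in> integer_lattice \<Longrightarrow> y \<in> integer_lattice \<Longrightarrow> x + y \<in> integer_lattice"
  and integer_lattice_diff: "x \<in> integer_lattice \<Longrightarrow> y \<in> integer_lattice \<Longrightarrow> x - y \<in> integer_lattice"
  and integer_lattice_scaleR: "x \<in> integer_lattice \<Longrightarrow> c \<in> \<int> \<Longrightarrow> c *\<^sub>R x \<in> integer_lattice"
  by (auto simp: integer_lattice_def)

lemma integer_lattice_sum:
  "(\<And>j. j \<in> A \<Longrightarrow> f j \<in> integer_lattice) \<Longrightarrow> sum f A \<in> integer_lattice"
  by (auto simp: integer_lattice_def intro: Ints_sum)

lemma vertex_in_integer_lattice: "lattice_tetrahedron v \<Longrightarrow> v j \<in> integer_lattice"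
  by (auto simp: lattice_tetrahedron_def)

lemma barycentric_coordinates_vertex: "barycentric_coordinates v (v k) (\<lambda>j. of_bool (j = k))"
proof -
  have "(\<Sum>j\<in>UNIV. of_bool (j = k) *\<^sub>R v j) = (\<Sum>j\<in>UNIV. if j = k then v j else 0)"
    by (rule sum.cong) auto
  then show ?thesis by (simp add: barycentric_coordinates_def)
qed

text \<open>A lattice point of the face opposite to \<open>v 1\<close> lies on the boundary, so
  cleanness makes it a vertex, and uniqueness makes its coordinates an indicator function.\<close>

lemma clean_face_coordinates:
  assumes clean: "clean_lattice_tetrahedron v"
    and bary: "barycentric_coordinates v y l" and y: "y \<in> integer_lattice"
    and l: "\<And>j. 0 \<le> l j" "l 1 = 0"
  shows "l j \<in> {0, 1}"
proof -
  have T: "lattice_tetrahedron v" using clean by (simp add: clean_lattice_tetrahedron_def)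
  have "y \<in> frontier (tetrahedron v)"
    unfolding frontier_tetrahedron[OF T] using bary l by blast
  then obtain k where "y = v k"
    using clean y by (auto simp: clean_lattice_tetrahedron_def)
  then have "l = (\<lambda>j. of_bool (j = k))"
    using barycentric_coordinates_unique[OF T bary] barycentric_coordinates_vertex[of v k] by blast
  then show ?thesis by simp
qed

text \<open>The two fractional parts describe a point of the parallelogram spanned by the empty
  triangle \<open>v 2\<close>, \<open>v 3\<close>, \<open>v 4\<close>; this point or its reflection lies in the triangle.\<close>

lemma clean_face_unimodular:
  assumes clean: "clean_lattice_tetrahedron v"
    and xy: "x *\<^sub>R (v 2 - v 4) + y *\<^sub>R (v 3 - v 4) \<in> integer_lattice"
  shows "x \<in> \<int>" "y \<in> \<int>"
proof -
  have T: "lattice_tetrahedron v" using clean by (simp add: clean_lattice_tetrahedron_def)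
  note V = vertex_in_integer_lattice[OF T]
  define a b where "a = frac x" and "b = frac y"
  have ab: "0 \<le> a" "a < 1" "0 \<le> b" "b < 1" by (simp_all add: a_def b_def frac_lt_1)
  have "x *\<^sub>R (v 2 - v 4) + y *\<^sub>R (v 3 - v 4)
      - (\<lfloor>x\<rfloor> *\<^sub>R (v 2 - v 4) + \<lfloor>y\<rfloor> *\<^sub>R (v 3 - v 4)) \<in> integer_lattice"
    by (intro integer_lattice_add integer_lattice_diff integer_lattice_scaleR V xy) auto
  then have p: "a *\<^sub>R (v 2 - v 4) + b *\<^sub>R (v 3 - v 4) \<in> integer_lattice"
    by (simp add: a_def b_def frac_def algebra_simps)
  have "a = 0 \<and> b = 0"
  proof (cases "a + b \<le> 1")
    case True
    let ?l = "(\<lambda>_. 0)(2 := a, 3 := b, 4 := 1 - a - b) :: 4 \<Rightarrow> real"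
    have "barycentric_coordinates v (v 4 + (a *\<^sub>R (v 2 - v 4) + b *\<^sub>R (v 3 - v 4))) ?l"
      by (simp add: barycentric_coordinates_def sum_4 algebra_simps)
    then have "?l j \<in> {0, 1}" for j
      by (rule clean_face_coordinates[OF clean])
        (use True ab in \<open>auto intro!: integer_lattice_add V p\<close>)
    from this[of 2] this[of 3] ab show ?thesis by simp
  next
    case False
    let ?l = "(\<lambda>_. 0)(2 := 1 - a, 3 := 1 - b, 4 := a + b - 1) :: 4 \<Rightarrow> real"
    have "barycentric_coordinates v
        (v 2 + v 3 - v 4 - (a *\<^sub>R (v 2 - v 4) + b *\<^sub>R (v 3 - v 4))) ?l"
      by (simp add: barycentric_coordinates_def sum_4 algebra_simps)
    then have "?l j \<in> {0, 1}" for j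
      by (rule clean_face_coordinates[OF clean])
        (use False ab in \<open>auto intro!: integer_lattice_add integer_lattice_diff V p\<close>)
    \<comment> \<open>This case is contradictory: \<open>a + b > 1\<close> with \<open>b < 1\<close>
      puts \<open>1 - a\<close> strictly between 0 and 1.\<close>
    from this[of 2] this[of 3] False ab show ?thesis by auto
  qed
  then show "x \<in> \<int>" "y \<in> \<int>" by (simp_all add: a_def b_def frac_eq_0_iff)
qed

section \<open>Volume, determinant and Cramer's rule\<close>

text \<open>The columns are the edges at \<open>v 4\<close>; the conditional embeds the index type
  \<open>3\<close> into the label type \<open>4\<close>.\<close>

definition edge_matrix :: "(4 \<Rightarrow> real^3) \<Rightarrow> real^3^3" where
  "edge_matrix v = (\<chi> i j. v (if j = 1 then 1 else if j = 2 then 2 else 3) $ i - v 4 $ i)"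

lemma measure_tetrahedron:
  assumes "lattice_tetrahedron v"
  shows "measure lebesgue (tetrahedron v) = \<bar>det (edge_matrix v)\<bar> / 6"
proof -
  have inj: "inj v" using assms by (simp add: lattice_tetrahedron_def)
  define h :: "3 \<Rightarrow> 4" where "h = (\<lambda>j. if j = 1 then 1 else if j = 2 then 2 else 3)"
  have h: "inj h" "range h = UNIV - {4}"
    unfolding inj_def h_def UNIV_3 UNIV_4 by (auto simp: forall_3)
  have "range (v \<circ> h) = v ` (UNIV - {4})" by (simp only: image_comp[symmetric] h)
  then have "bij_betw (v \<circ> h) UNIV (range v - {v 4})"
    unfolding bij_betw_def using inj h by (simp only: inj_compose image_set_diff) simp
  then have "measure lborel (convex hull (range v)) =
      \<bar>det (\<chi> i j. (v \<circ> h) j $ i - v 4 $ i)\<bar> / fact CARD(3)"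
    by (intro content_simplex) (auto simp: o_def card_range_vertices[OF assms])
  moreover have "(\<chi> i j. (v \<circ> h) j $ i - v 4 $ i) = edge_matrix v"
    by (simp add: edge_matrix_def h_def)
  \<comment> \<open>The simplex is compact, hence Borel, so completing the measure does not change
    its volume.\<close>
  moreover have "measure lebesgue (convex hull (range v)) = measure lborel (convex hull (range v))"
    by (intro measure_completion) (auto intro!: borel_compact finite_imp_compact_convex_hull)
  ultimately show ?thesis by (simp add: tetrahedron_def fact_numeral)
qed

lemma barycentric_coordinate_times_det:
  assumes T: "lattice_tetrahedron v" and u: "u \<in> integer_lattice"
    and bary: "barycentric_coordinates v u l"
  shows "l 1 * det (edge_matrix v) \<in> \<int>"
proof -
  have l4: "l 4 = 1 - l 1 - l 2 - l 3" and
    ui: "u $ i = l 1 * v 1 $ i + l 2 * v 2 $ i + l 3 * v 3 $ i + l 4 * v 4 $ i" for i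
    using bary by (auto simp: barycentric_coordinates_def sum_4)
  have V: "v j $ i \<in> \<int>" for i j
    using vertex_in_integer_lattice[OF T, of j] by (simp add: integer_lattice_def)
  have U: "u $ i \<in> \<int>" for i using u by (simp add: integer_lattice_def)
  \<comment> \<open>Cramer's rule: \<open>u - v 4\<close> is the combination of the three edges with
    weights \<open>l 1\<close>, \<open>l 2\<close>, \<open>l 3\<close>, so putting it in the first
    column scales the determinant by \<open>l 1\<close>.\<close>
  have "l 1 * det (edge_matrix v) = det (edge_matrix (v(1 := u)))"
    by (simp add: det_3 edge_matrix_def ui l4) (simp add: algebra_simps)
  also have "\<dots> \<in> \<int>"
    by (auto simp: det_3 edge_matrix_def intro!: Ints_add Ints_diff Ints_mult U V)
  finally show ?thesis .
qed

section \<open>Fractional parts and multiples of the interior point\<close>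

text \<open>Removing integer parts keeps the sum an integer, and non-integral terms make it
  positive; 1 is the only such value not above 1.\<close>

lemma frac_sum_one:
  fixes f :: "'a::finite \<Rightarrow> real"
  assumes "(\<Sum>j\<in>UNIV. f j) \<in> \<int>" "\<And>j. f j \<notin> \<int>" "\<not> (\<Sum>j\<in>UNIV. frac (f j)) > 1"
  shows "(\<Sum>j\<in>UNIV. frac (f j)) = 1"
proof -
  have "(\<Sum>j\<in>UNIV. f j) - (\<Sum>j\<in>UNIV. of_int \<lfloor>f j\<rfloor>) \<in> \<int>"
    using assms(1) by auto
  then have "(\<Sum>j\<in>UNIV. frac (f j)) \<in> \<int>"
    by (simp add: frac_def sum_subtractf)
  moreover have "(\<Sum>j\<in>UNIV. frac (f j)) > 0"
    using assms(2) by (intro sum_pos) (auto simp: frac_gt_0_iff)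
  ultimately show ?thesis using assms(3) by (auto elim!: Ints_cases)
qed

lemma not_Ints_multiple_div:
  fixes s :: int and d N :: nat
  assumes "gcd d N = 1" "\<not> int N dvd s" "N > 0"
  shows "of_int s * real d / real N \<notin> \<int>"
proof
  assume "of_int s * real d / real N \<in> \<int>"
  then obtain k where "of_int s * real d / real N = of_int k" by (auto elim: Ints_cases)
  then have "real_of_int (s * int d) = real_of_int (k * int N)"
    using assms(3) by (simp add: field_simps)
  then have "s * int d = k * int N" by (simp only: of_int_eq_iff)
  then have "int N dvd s * int d" by simp
  moreover have "coprime (int N) (int d)" using assms(1) by (simp add: coprime_iff_gcd_eq_1 gcd.commute)
  ultimately have "int N dvd s" by (simp add: coprime_dvd_mult_left_iff)
  then show False using assms(2) by simp
qed

text \<open>Subtracting integer multiples of the vertices from \<open>s\<close> times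
  \<open>w\<close> stays in the lattice and leaves the fractional parts as weights; total weight 1
  turns these into barycentric coordinates.\<close>

lemma barycentric_coordinates_frac_multiple:
  assumes T: "lattice_tetrahedron v" and w: "w \<in> integer_lattice"
    and bary: "barycentric_coordinates v w l"
    and one: "(\<Sum>j\<in>UNIV. frac (of_int s * l j)) = 1"
  obtains u where "u \<in> integer_lattice" "barycentric_coordinates v u (\<lambda>j. frac (of_int s * l j))"
proof
  let ?u = "of_int s *\<^sub>R w - (\<Sum>j\<in>UNIV. of_int \<lfloor>of_int s * l j\<rfloor> *\<^sub>R v j)"
  show "?u \<in> integer_lattice"
    by (intro integer_lattice_diff integer_lattice_scaleR integer_lattice_sum w
        vertex_in_integer_lattice[OF T]) auto
  show "barycentric_coordinates v ?u (\<lambda>j. frac (of_int s * l j))"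
    using bary one
    by (simp add: barycentric_coordinates_def frac_def scaleR_diff_left sum_subtractf
        scaleR_sum_right)
qed

section \<open>The two implications\<close>

text \<open>A failing \<open>s\<close> gives an interior lattice point, which must be
  \<open>w\<close>. The range of \<open>s\<close> is such that \<open>N\<close> divides neither
  \<open>s\<close> (so the point is interior) nor \<open>s - 1\<close> (so it is not
  \<open>w\<close>).\<close>

lemma one_point_frac_sum_gt_one:
  assumes one: "one_point_lattice_tetrahedron v"
    and w: "w \<in> integer_lattice" "w \<in> interior (tetrahedron v)"
    and bary: "barycentric_coordinates v w (\<lambda>j. real (d j) / real N)"
    and d: "(\<Sum>j\<in>UNIV. d j) = N" "\<And>j. gcd (d j) N = 1"
    and s: "2 \<le> s" "s \<le> int N - 1"
  shows "(\<Sum>j\<in>UNIV. frac (of_int s * real (d j) / real N)) > 1"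
proof (rule ccontr)
  assume neg: "\<not> ?thesis"
  have T: "lattice_tetrahedron v"
    using one by (simp add: one_point_lattice_tetrahedron_def clean_lattice_tetrahedron_def)
  have N: "N > 0" using s by linarith
  have "\<not> int N dvd s" using s zdvd_imp_le[of "int N" s] by linarith
  then have nz: "of_int s * real (d j) / real N \<notin> \<int>" for j
    using not_Ints_multiple_div d(2) N by blast
  have "(\<Sum>j\<in>UNIV. of_int s * real (d j) / real N) = of_int s * real (\<Sum>j\<in>UNIV. d j) / real N"
    by (simp add: sum_distrib_left sum_divide_distrib)
  also have "\<dots> \<in> \<int>" using N by (simp add: d(1))
  finally have eq1: "(\<Sum>j\<in>UNIV. frac (of_int s * real (d j) / real N)) = 1"
    using frac_sum_one[of "\<lambda>j. of_int s * real (d j) / real N"] nz neg by blast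
  then obtain u where u: "u \<in> integer_lattice"
    "barycentric_coordinates v u (\<lambda>j. frac (of_int s * real (d j) / real N))"
    using barycentric_coordinates_frac_multiple[OF T w(1) bary, of s] by auto
  have "\<forall>j. 0 < frac (of_int s * real (d j) / real N)" using nz by (simp add: frac_gt_0_iff)
  then have "u \<in> interior (tetrahedron v)"
    unfolding interior_tetrahedron[OF T] using u(2) by (intro CollectI exI conjI)
  moreover obtain z where "interior (tetrahedron v) \<inter> integer_lattice = {z}"
    using one unfolding one_point_lattice_tetrahedron_def by (metis card_1_singletonE)
  ultimately have "u = w" using w u(1) by (metis IntI singletonD)
  then have "frac (of_int s * real (d 1) / real N) = real (d 1) / real N"
    using barycentric_coordinates_unique[OF T u(2)] bary by metis
  then have "of_int s * real (d 1) / real N - real (d 1) / real N \<in> \<int>"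
    by (metis Ints_of_int add_diff_cancel_left' frac_def diff_add_cancel diff_diff_eq2)
  then have "of_int (s - 1) * real (d 1) / real N \<in> \<int>"
    by (simp add: algebra_simps diff_divide_distrib)
  moreover have "\<not> int N dvd s - 1" using s zdvd_imp_le[of "int N" "s - 1"] by linarith
  ultimately show False using not_Ints_multiple_div d(2) N by blast
qed

lemma frac_sum_gt_one_imp_one_point:
  assumes clean: "clean_lattice_tetrahedron v"
    and vol: "measure lebesgue (tetrahedron v) = real N / 6"
    and w: "w \<in> integer_lattice" "w \<in> interior (tetrahedron v)"
    and bary: "barycentric_coordinates v w (\<lambda>j. real (d j) / real N)"
    and d: "gcd (d 1) N = 1" and N: "N > 0"
    and gt: "\<And>s. 2 \<le> s \<Longrightarrow> s \<le> int N - 1 \<Longrightarrow>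
      (\<Sum>j\<in>UNIV. frac (of_int s * real (d j) / real N)) > 1"
  shows "one_point_lattice_tetrahedron v"
proof -
  have T: "lattice_tetrahedron v" using clean by (simp add: clean_lattice_tetrahedron_def)
  note V = vertex_in_integer_lattice[OF T]
  have D: "real N = \<bar>det (edge_matrix v)\<bar>" using vol measure_tetrahedron[OF T] by simp
  have "u = w" if u: "u \<in> integer_lattice" "u \<in> interior (tetrahedron v)" for u
  proof -
    obtain m where m: "\<And>j. 0 < m j" "barycentric_coordinates v u m"
      using u(2) unfolding interior_tetrahedron[OF T] by auto
    have sum1: "m 1 + m 2 + m 3 + m 4 = 1"
      using m(2) by (simp add: barycentric_coordinates_def sum_4)
    then have m_lt: "m j < 1" for j
      using m(1)[of 1] m(1)[of 2] m(1)[of 3] m(1)[of 4] exhaust_4[of j] by auto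
    have "m 1 * real N \<in> \<int>"
      using barycentric_coordinate_times_det[OF T u(1) m(2)] by (auto simp: D abs_if)
    then obtain k where k: "m 1 * real N = of_int k" by (auto elim: Ints_cases)
    \<comment> \<open>The multiplier is \<open>k\<close> times an inverse of \<open>d 1\<close>
      modulo \<open>N\<close>, chosen so that \<open>u\<close> and \<open>s0\<close> times
      \<open>w\<close> agree in the first coordinate modulo 1.\<close>
    obtain s0 where s0: "[int (d 1) * s0 = k] (mod int N)"
    proof -
      obtain x where "[int (d 1) * x = 1] (mod int N)"
        using d cong_solve_coprime_int[of "int (d 1)" "int N"]
        by (auto simp: coprime_iff_gcd_eq_1)
      then have "[int (d 1) * x * k = 1 * k] (mod int N)" by (rule cong_scalar_right)
      then show ?thesis using that[of "x * k"] by (simp add: mult.assoc)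
    qed
    define s where "s = s0 mod int N"
    have s: "0 \<le> s" "s \<le> int N - 1" using N by (simp_all add: s_def zle_diff1_eq)
    have "[int (d 1) * s = k] (mod int N)"
      using s0 by (simp add: s_def cong_def mod_mult_right_eq)
    then obtain q where "k = int (d 1) * s + int N * q"
      by (auto simp: cong_iff_lin)
    \<comment> \<open>These are the weights of \<open>u\<close> minus \<open>s\<close> times
      \<open>w\<close>, with total \<open>1 - s\<close>. The aim is that all four are
      integers.\<close>
    define c where "c = (\<lambda>j. m j - of_int s * real (d j) / real N)"
    have c1: "c 1 = of_int q"
    proof -
      have "m 1 * real N = of_int s * real (d 1) + real N * of_int q"
        unfolding k \<open>k = _\<close> by simp
      then show ?thesis using N by (simp add: c_def field_simps)
    qed
    have csum: "c 1 + c 2 + c 3 + c 4 = 1 - of_int s"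
    proof -
      have "of_int s * (real (d 1) / real N + real (d 2) / real N + real (d 3) / real N
          + real (d 4) / real N) = of_int s * 1"
        using bary by (simp add: barycentric_coordinates_def sum_4)
      then show ?thesis using sum1 by (simp add: c_def algebra_simps)
    qed
    \<comment> \<open>Eliminating \<open>c 4\<close> leaves only the two edges of the empty face
      with weights not yet known to be integers, so unimodularity of that face applies.\<close>
    have c4: "c 4 = 1 - of_int s - of_int q - c 2 - c 3" using csum c1 by simp
    have "u - of_int s *\<^sub>R w = c 1 *\<^sub>R v 1 + c 2 *\<^sub>R v 2 + c 3 *\<^sub>R v 3 + c 4 *\<^sub>R v 4"
      using bary m(2) by (simp add: barycentric_coordinates_def sum_4 c_def algebra_simps)
    also have "\<dots> = c 2 *\<^sub>R (v 2 - v 4) + c 3 *\<^sub>R (v 3 - v 4)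
        + (of_int q *\<^sub>R v 1 + (1 - of_int s - of_int q) *\<^sub>R v 4)"
      unfolding c4 c1 by (simp add: algebra_simps)
    finally have "c 2 *\<^sub>R (v 2 - v 4) + c 3 *\<^sub>R (v 3 - v 4) = u - of_int s *\<^sub>R w
        - (of_int q *\<^sub>R v 1 + (1 - of_int s - of_int q) *\<^sub>R v 4)"
      by simp
    also have "\<dots> \<in> integer_lattice"
      by (intro integer_lattice_add integer_lattice_diff integer_lattice_scaleR V u w) auto
    finally have c23: "c 2 \<in> \<int>" "c 3 \<in> \<int>" by (rule clean_face_unimodular[OF clean])+
    have "c 4 \<in> \<int>" unfolding c4 using c23 by auto
    then have cZ: "c j \<in> \<int>" for j using c1 c23 exhaust_4[of j] by auto
    \<comment> \<open>Each \<open>m j\<close> lies strictly between 0 and 1 and differs from the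
      multiple by an integer, hence is its fractional part.\<close>
    have mfrac: "frac (of_int s * real (d j) / real N) = m j" for j
      using m(1)[of j] m_lt[of j] Ints_minus[OF cZ[of j]] by (simp add: frac_unique_iff c_def)
    \<comment> \<open>The \<open>m j\<close> sum to exactly 1, against \<open>gt\<close>; and
      \<open>s = 0\<close> would make them vanish.\<close>
    have "\<not> 2 \<le> s"
      using gt[of s] s sum1 by (auto simp: mfrac sum_4)
    moreover have "s \<noteq> 0" using mfrac[of 1] m(1)[of 1] by auto
    ultimately have s1: "s = 1" using s by linarith
    \<comment> \<open>Interiority of \<open>w\<close> places every \<open>d j / N\<close> strictly
      between 0 and 1, so for \<open>s = 1\<close> taking fractional parts changes nothing.\<close>
    obtain l where l: "\<And>j. 0 < l j" "barycentric_coordinates v w l"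
      using w(2) unfolding interior_tetrahedron[OF T] by auto
    have dl: "real (d j) / real N = l j" for j
      using barycentric_coordinates_unique[OF T bary l(2)] by metis
    have "l 1 + l 2 + l 3 + l 4 = 1"
      using l(2) by (simp add: barycentric_coordinates_def sum_4)
    then have "l j < 1" for j
      using l(1)[of 1] l(1)[of 2] l(1)[of 3] l(1)[of 4] exhaust_4[of j] by auto
    then have "m j = l j" for j
      using mfrac[of j] l(1)[of j] by (simp add: s1 dl frac_eq less_imp_le)
    then show ?thesis using m(2) l(2) by (simp add: barycentric_coordinates_def)
  qed
  then have "interior (tetrahedron v) \<inter> integer_lattice = {w}" using w by blast
  then show ?thesis using clean by (simp add: one_point_lattice_tetrahedron_def)
qed

theorem theorem8:
  fixes v :: "4 \<Rightarrow> real^3" and w :: "real^3"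
    and d :: "4 \<Rightarrow> nat" and n N :: nat and g :: real
  assumes "clean_lattice_tetrahedron v"
    and "measure lebesgue (tetrahedron v) = real n / 6"
    and "w \<in> integer_lattice"
    and "w \<in> interior (tetrahedron v)"
    and "barycentric_coordinates v w (\<lambda>j. real (d j) / real N)"
    and "\<And>j. d j > 0"
    and "(\<Sum>j\<in>UNIV. d j) = N"
    and "\<And>j. gcd (d j) N = 1"
    and "g = real n / real N"
  shows "(one_point_lattice_tetrahedron v \<longrightarrow>
            (\<forall>s::int. 2 \<le> s \<and> s \<le> int N - 1 \<longrightarrow>
               (\<Sum>j\<in>UNIV. frac (real_of_int s * real (d j) / real N)) > 1)) \<and>
         (g = 1 \<and>
            (\<forall>s::int. 2 \<le> s \<and> s \<le> int N - 1 \<longrightarrow>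
               (\<Sum>j\<in>UNIV. frac (real_of_int s * real (d j) / real N)) > 1) \<longrightarrow>
          one_point_lattice_tetrahedron v)"
proof (intro conjI impI allI)
  fix s :: int
  assume "one_point_lattice_tetrahedron v" "2 \<le> s \<and> s \<le> int N - 1"
  then show "(\<Sum>j\<in>UNIV. frac (real_of_int s * real (d j) / real N)) > 1"
    using one_point_frac_sum_gt_one[OF _ assms(3,4,5,7,8)] by blast
next
  assume gt: "g = 1 \<and> (\<forall>s::int. 2 \<le> s \<and> s \<le> int N - 1 \<longrightarrow>
    (\<Sum>j\<in>UNIV. frac (real_of_int s * real (d j) / real N)) > 1)"
  \<comment> \<open>For \<open>N = 0\<close> the quotient defining \<open>g\<close> would be 0, so
    \<open>g = 1\<close> also yields positivity of \<open>N\<close>.\<close>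
  have "N > 0" "n = N" using gt assms(9) by (cases "N = 0"; simp)+
  then show "one_point_lattice_tetrahedron v"
    using frac_sum_gt_one_imp_one_point[OF assms(1) _ assms(3,4,5,8)] assms(2) gt by blast
qed

end
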